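(* Let $q,r$ be the functions defining the 1-constrained CKP hierarchy, with Lax operator $\mathcal{L}=\partial+q\partial^{-1}r+r\partial^{-1}q$, and let $q_{t_m}=B_m(q)$, $r_{t_m}=B_m(r)$, where $B_m=(\mathcal{L}^m)_+$, denote its flows, $m=1,3,5,\dots$. Define the four operators $$\begin{aligned} R_{11}={}&\mathcal{L}^2+3qr+\mathcal{L}(r)\partial^{-1}q+2q_x\partial^{-1}r-q\partial^{-1}qr\partial^{-1}r-r\partial^{-1}q\partial-r\partial^{-1}q^2\partial^{-1}r\\ &-2r\partial^{-1}rq\partial^{-1}q-r\partial^{-1}q\Big(\int rq\Big)-q\partial^{-1}q\Big(\int r^2\Big),\\ R_{12}={}&2q_x\partial^{-1}q+3q^2-2q\partial^{-1}q^2\partial^{-1}r-q\partial^{-1}q\partial-q\partial^{-1}qr\partial^{-1}q-r\partial^{-1}q^2\partial^{-1}q\\ &-q\partial^{-1}q\Big(\int rq\Big)-r\partial^{-1}q\Big(\int q^2\Big)+\mathcal{L}(q)\partial^{-1}q,\\ R_{21}={}&2r_x\partial^{-1}r+3r^2-2r\partial^{-1}r^2\partial^{-1}q-r\partial^{-1}r\partial-r\partial^{-1}qr\partial^{-1}r-q\partial^{-1}r^2\partial^{-1}r\\ &-r\partial^{-1}r\Big(\int rq\Big)-q\partial^{-1}r\Big(\int r^2\Big)+\mathcal{L}(r)\partial^{-1}r,\\ R_{22}={}&\mathcal{L}^2+3qr+\mathcal{L}(q)\partial^{-1}r+2r_x\partial^{-1}q-r\partial^{-1}qr\partial^{-1}q-q\partial^{-1}r\partial-q\partial^{-1}r^2\partial^{-1}q\\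 &-2q\partial^{-1}qr\partial^{-1}r-q\partial^{-1}r\Big(\int rq\Big)-r\partial^{-1}r\Big(\int q^2\Big). \end{aligned}$$ Then for every odd integer $m\ge 1$, $$\begin{pmatrix} q\\ r\end{pmatrix}_{t_{m+2}}=\begin{pmatrix} R_{11}&R_{12}\\ R_{21}&R_{22}\end{pmatrix}\begin{pmatrix} q\\ r\end{pmatrix}_{t_m},$$ that is, $q_{t_{m+2}}=R_{11}(q_{t_m})+R_{12}(r_{t_m})$ and $r_{t_{m+2}}=R_{21}(q_{t_m})+R_{22}(r_{t_m})$.
   Context: Functions and antiderivatives. Functions of $x$ (depending also on parameters $t_1,t_3,t_5,\dots$) are taken in a commutative, not necessarily unital, algebra $\mathcal{A}$ with derivation $\partial=\partial_x$ (also written with subscript $x$) that is bijective on $\mathcal{A}$; for instance smooth functions all of whose $x$-derivatives decay exponentially as $x\to-\infty$. The inverse is $\partial^{-1}f=\int f$ (in the example, $\int_{-\infty}^x f$), i.e. formal antiderivatives are taken with integration constants zero, so $\partial\partial^{-1}=\partial^{-1}\partial=1$. Take $q,r\in\mathcal{A}$. Pseudo-differential operators. These are formal series $P=\sum_{i\le N}p_i\partial^i$ (coefficients functions or constants) with multiplication determined by $\partial^i f=\sum_{k\ge0}\binom{i}{k}(\partial^k f)\,\partial^{i-k}$, $i\in\mathbb{Z}$. Write $P_+=\sum_{i\ge0}p_i\partial^i$. The adjoint is $P^*=\sum_i(-1)^i\partial^i p_i$. 1-constrained CKP hierarchy. Its Lax operator is $\mathcal{L}=\partial+q\partial^{-1}r+r\partial^{-1}q$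 (so $\mathcal{L}^*=-\mathcal{L}$). Put $B_m=(\mathcal{L}^m)_+$, a differential operator. Only odd flows are present: $\partial\mathcal{L}/\partial t_{2n+1}=[B_{2n+1},\mathcal{L}]$, $n\ge 0$, where $q,r$ satisfy the eigenfunction equations $q_{t_m}=B_m(q)$, $r_{t_m}=-B_m^*(r)=B_m(r)$ for odd $m$. For example $B_1=\partial$ and $B_3=\partial^3+6qr\partial+3rq_x+3qr_x$. Reading of the operators. A product such as $q\partial^{-1}qr\partial^{-1}r$ is a composition of operators on functions, where functions act by multiplication: $f\mapsto q\,\partial^{-1}\big(qr\,\partial^{-1}(rf)\big)$; likewise $r\partial^{-1}q\partial$ is $f\mapsto r\,\partial^{-1}(qf_x)$, and $r\partial^{-1}q(\int rq)$ is $f\mapsto r\,\partial^{-1}\big(q(\int rq)f\big)$. $\mathcal{L}$ acts on functions by $\mathcal{L}(f)=f_x+q\,\partial^{-1}(rf)+r\,\partial^{-1}(qf)$, and $\mathcal{L}^2$ is $\mathcal{L}$ applied twice. $\mathcal{L}(q)$ and $\mathcal{L}(r)$ denote the functions $\mathcal{L}(q)=q_x+q\int rq+r\int q^2$ and $\mathcal{L}(r)=r_x+q\int r^2+r\int qr$, acting by multiplication. *)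

theory Defs
  imports Complex_Main "HOL-Library.Product_Plus"
begin

text \<open>
  Functions form a commutative, not necessarily unital algebra over a commutative ring of
  constants. A coefficient of a pseudo-differential operator is a constant or a function, or a
  sum of both: the pair (c, f) stands for c + f in the unitization of the algebra.

  A pseudo-differential operator is its family of coefficients, which vanish above some order:
  the operator P is the sum of (coeff P i) times the i-th power of the derivation.
\<close>

typedef (overloaded) ('k::zero, 'a::zero) pdo =
  "{p :: int \<Rightarrow> 'k \<times> 'a. \<exists>N. \<forall>i>N. p i = 0}"
  morphisms coeff Abs_pdo
  by (rule exI[of _ "\<lambda>_. 0"]) simp

setup_lifting type_definition_pdo

instantiation pdo :: (ab_group_add, ab_group_add) ab_group_add
begin

lift_definition zero_pdo :: "('a, 'b) pdo" is "\<lambda>_. 0" by simp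

lift_definition plus_pdo :: "('a, 'b) pdo \<Rightarrow> ('a, 'b) pdo \<Rightarrow> ('a, 'b) pdo"
  is "\<lambda>p q i. p i + q i"
proof -
  fix p q :: "int \<Rightarrow> 'a \<times> 'b"
  assume "\<exists>N. \<forall>i>N. p i = 0" and "\<exists>N. \<forall>i>N. q i = 0"
  then obtain M N where "\<forall>i>M. p i = 0" and "\<forall>i>N. q i = 0" by blast
  then have "\<forall>i>max M N. p i + q i = 0" by simp
  then show "\<exists>N. \<forall>i>N. p i + q i = 0" ..
qed

lift_definition uminus_pdo :: "('a, 'b) pdo \<Rightarrow> ('a, 'b) pdo" is "\<lambda>p i. - p i"
  by auto

definition minus_pdo :: "('a, 'b) pdo \<Rightarrow> ('a, 'b) pdo \<Rightarrow> ('a, 'b) pdo"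
  where "minus_pdo p q = p + - q"

instance
  by standard (simp_all add: minus_pdo_def, (transfer, simp add: algebra_simps fun_eq_iff)+)

end

lift_definition monomial :: "'k::zero \<times> 'a::zero \<Rightarrow> int \<Rightarrow> ('k, 'a) pdo"
  is "\<lambda>a n i. if i = n then a else 0"
proof -
  fix a :: "'k \<times> 'a" and n :: int
  have "\<forall>i>n. (if i = n then a else 0) = 0" by simp
  then show "\<exists>N. \<forall>i>N. (if i = n then a else 0) = 0" ..
qed

abbreviation D_pow :: "int \<Rightarrow> ('k::zero_neq_one, 'a::zero) pdo"
  where "D_pow n \<equiv> monomial (1, 0) n"

abbreviation mult_by :: "'a::zero \<Rightarrow> ('k::zero, 'a) pdo"
  where "mult_by f \<equiv> monomial (0, f) 0"

lift_definition pos_part :: "('k::zero, 'a::zero) pdo \<Rightarrow> ('k, 'a) pdo"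
  is "\<lambda>p i. if 0 \<le> i then p i else 0"
  by auto

text \<open>This unfolds (gchoose) on the integers; the sort constraint of (gchoose) restricts its use
  to fields of characteristic zero. The division is exact.\<close>

definition int_binomial :: "int \<Rightarrow> nat \<Rightarrow> int"
  where "int_binomial i k = (\<Prod>l = 0..<k. i - int l) div fact k"

locale differential_algebra = module scale
  for scale :: "'k::comm_ring_1 \<Rightarrow> 'a::comm_ring \<Rightarrow> 'a"  (infixr \<open>*s\<close> 75) +
  fixes derivation :: "'a \<Rightarrow> 'a"  (\<open>\<partial>\<close>)
  assumes scale_mult_left: "(c *s f) * g = c *s (f * g)"
    and derivation_add: "\<partial> (f + g) = \<partial> f + \<partial> g"
    and derivation_scale: "\<partial> (c *s f) = c *s \<partial> f"
    and derivation_mult: "\<partial> (f * g) = \<partial> f * g + f * \<partial> g"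
    and bij_derivation: "bij \<partial>"
begin

abbreviation antiderivative :: "'a \<Rightarrow> 'a"  (\<open>\<integral>\<close>)
  where "\<integral> \<equiv> inv \<partial>"

fun coeff_mult :: "'k \<times> 'a \<Rightarrow> 'k \<times> 'a \<Rightarrow> 'k \<times> 'a"
  where "coeff_mult (b, f) (c, g) = (b * c, b *s g + c *s f + f * g)"

fun coeff_deriv :: "'k \<times> 'a \<Rightarrow> 'k \<times> 'a"
  where "coeff_deriv (c, f) = (0, \<partial> f)"

fun coeff_act :: "'k \<times> 'a \<Rightarrow> 'a \<Rightarrow> 'a"
  where "coeff_act (c, g) f = c *s f + g * f"

text \<open>
  The product extends the rule that moves a power of the derivation past a function. The term
  with indices i, j and k has order i + j - k, so for a given order n the pair (i, j) determines
  k. Only finitely many pairs contribute, as both families of coefficients vanish in high order.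
\<close>

definition product_term ::
    "(int \<Rightarrow> 'k \<times> 'a) \<Rightarrow> (int \<Rightarrow> 'k \<times> 'a) \<Rightarrow> int \<Rightarrow> int \<Rightarrow> nat \<Rightarrow> 'k \<times> 'a"
  where "product_term p q i j k =
    coeff_mult (of_int (int_binomial i k), 0) (coeff_mult (p i) ((coeff_deriv ^^ k) (q j)))"

lift_definition pdo_mult :: "('k, 'a) pdo \<Rightarrow> ('k, 'a) pdo \<Rightarrow> ('k, 'a) pdo"  (infixl \<open>\<odot>\<close> 70)
  is "\<lambda>p q n. \<Sum>(i, j) \<in> {(i, j). p i \<noteq> 0 \<and> q j \<noteq> 0 \<and> n \<le> i + j}.
        product_term p q i j (nat (i + j - n))"
proof -
  fix p q :: "int \<Rightarrow> 'k \<times> 'a"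
  assume "\<exists>N. \<forall>i>N. p i = 0" and "\<exists>N. \<forall>i>N. q i = 0"
  then obtain M N where M: "\<And>i. p i \<noteq> 0 \<Longrightarrow> i \<le> M" and N: "\<And>i. q i \<noteq> 0 \<Longrightarrow> i \<le> N"
    by (meson not_le)
  have "{(i, j). p i \<noteq> 0 \<and> q j \<noteq> 0 \<and> n \<le> i + j} = {}" if "n > M + N" for n
    using M N that by fastforce
  then show "\<exists>N. \<forall>n>N. (\<Sum>(i, j) \<in> {(i, j). p i \<noteq> 0 \<and> q j \<noteq> 0 \<and> n \<le> i + j}.
      product_term p q i j (nat (i + j - n))) = 0"
    by (intro exI[of _ "M + N"]) (metis (no_types, lifting) sum.empty)
qed

definition pdo_power :: "('k, 'a) pdo \<Rightarrow> nat \<Rightarrow> ('k, 'a) pdo"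
  where "pdo_power P m = (pdo_mult P ^^ m) (D_pow 0)"

text \<open>Action on a function; meaningful only for differential operators, whose coefficients of
  negative order vanish.\<close>

definition pdo_apply :: "('k, 'a) pdo \<Rightarrow> 'a \<Rightarrow> 'a"
  where "pdo_apply P f =
    (\<Sum>i \<in> {i. 0 \<le> i \<and> coeff P i \<noteq> 0}. coeff_act (coeff P i) ((\<partial> ^^ nat i) f))"

definition lax :: "'a \<Rightarrow> 'a \<Rightarrow> ('k, 'a) pdo"
  where "lax q r = D_pow 1 + mult_by q \<odot> D_pow (-1) \<odot> mult_by r
                           + mult_by r \<odot> D_pow (-1) \<odot> mult_by q"

definition B :: "'a \<Rightarrow> 'a \<Rightarrow> nat \<Rightarrow> ('k, 'a) pdo"
  where "B q r m = pos_part (pdo_power (lax q r) m)"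

definition lax_fun :: "'a \<Rightarrow> 'a \<Rightarrow> 'a \<Rightarrow> 'a"
  where "lax_fun q r f = \<partial> f + q * \<integral> (r * f) + r * \<integral> (q * f)"

definition R11 :: "'a \<Rightarrow> 'a \<Rightarrow> 'a \<Rightarrow> 'a"
  where "R11 q r f =
    lax_fun q r (lax_fun q r f) + 3 *s (q * r * f) + lax_fun q r r * \<integral> (q * f)
    + 2 *s (\<partial> q * \<integral> (r * f)) - q * \<integral> (q * r * \<integral> (r * f)) - r * \<integral> (q * \<partial> f)
    - r * \<integral> (q * q * \<integral> (r * f)) - 2 *s (r * \<integral> (r * q * \<integral> (q * f)))
    - r * \<integral> (q * \<integral> (r * q) * f) - q * \<integral> (q * \<integral> (r * r) * f)"

definition R12 :: "'a \<Rightarrow> 'a \<Rightarrow> 'a \<Rightarrow> 'a"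
  where "R12 q r f =
    2 *s (\<partial> q * \<integral> (q * f)) + 3 *s (q * q * f) - 2 *s (q * \<integral> (q * q * \<integral> (r * f)))
    - q * \<integral> (q * \<partial> f) - q * \<integral> (q * r * \<integral> (q * f)) - r * \<integral> (q * q * \<integral> (q * f))
    - q * \<integral> (q * \<integral> (r * q) * f) - r * \<integral> (q * \<integral> (q * q) * f) + lax_fun q r q * \<integral> (q * f)"

definition R21 :: "'a \<Rightarrow> 'a \<Rightarrow> 'a \<Rightarrow> 'a"
  where "R21 q r f =
    2 *s (\<partial> r * \<integral> (r * f)) + 3 *s (r * r * f) - 2 *s (r * \<integral> (r * r * \<integral> (q * f)))
    - r * \<integral> (r * \<partial> f) - r * \<integral> (q * r * \<integral> (r * f)) - q * \<integral> (r * r * \<integral> (r * f))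
    - r * \<integral> (r * \<integral> (r * q) * f) - q * \<integral> (r * \<integral> (r * r) * f) + lax_fun q r r * \<integral> (r * f)"

definition R22 :: "'a \<Rightarrow> 'a \<Rightarrow> 'a \<Rightarrow> 'a"
  where "R22 q r f =
    lax_fun q r (lax_fun q r f) + 3 *s (q * r * f) + lax_fun q r q * \<integral> (r * f)
    + 2 *s (\<partial> r * \<integral> (q * f)) - r * \<integral> (q * r * \<integral> (q * f)) - q * \<integral> (r * \<partial> f)
    - q * \<integral> (r * r * \<integral> (q * f)) - 2 *s (q * \<integral> (q * r * \<integral> (r * f)))
    - q * \<integral> (r * \<integral> (r * q) * f) - r * \<integral> (r * \<integral> (q * q) * f)"

text \<open>
  The map dt m is the derivative with respect to the m-th time. Nothing is required of it except
  the eigenfunction equations of the odd flows. A time derivation that commutes with the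
  derivation and satisfies them also satisfies the Lax equation, which therefore is not required
  separately.
\<close>

definition CKP_flow :: "'a \<Rightarrow> 'a \<Rightarrow> (nat \<Rightarrow> 'a \<Rightarrow> 'a) \<Rightarrow> bool"
  where "CKP_flow q r dt \<longleftrightarrow>
    (\<forall>m. odd m \<longrightarrow> dt m q = pdo_apply (B q r m) q \<and> dt m r = pdo_apply (B q r m) r)"

end

end

theory Submission
  imports Defs
begin

text \<open>
  Let \<open>P\<close> be the \<open>m\<close>-th power of the Lax operator. Its integral part is the sum over \<open>i < m\<close> of
  \<open>(-1)\<^sup>i (L\<^bsup>m-1-i\<^esup>(q) \<partial>\<^bsup>-1\<^esup> L\<^sup>i(r) + L\<^bsup>m-1-i\<^esup>(r) \<partial>\<^bsup>-1\<^esup> L\<^sup>i(q))\<close>,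
  so its differential part \<open>B\<^sub>m\<close> acts on functions as \<open>L\<^sup>m\<close> minus this sum. The sum shows that
  the adjoint of \<open>B\<^sub>m\<close> is \<open>(-1)\<^sup>m B\<^sub>m\<close>, that the residue \<open>S\<^sub>m\<close> of \<open>P\<close> vanishes for even \<open>m\<close>,
  and that its derivative is \<open>2 (r B\<^sub>m(q) + q B\<^sub>m(r))\<close> for odd \<open>m\<close>. Taking the differential part
  of the product of the Lax operator and \<open>P\<close> then gives
  \<open>B\<^bsub>m+1\<^esub>(f) = L(B\<^sub>m(f)) + S\<^sub>m f - (-1)\<^sup>m (q \<integral> (B\<^sub>m(r) f) + r \<integral> (B\<^sub>m(q) f))\<close>.
  Two such steps starting at an odd \<open>m\<close>, followed by integrations by parts, are the recursion.
\<close>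

section \<open>Binomial coefficients with upper index one or negative\<close>

lemma int_binomial_0 [simp]: "int_binomial i 0 = 1"
  by (simp add: int_binomial_def)

lemma int_binomial_one: "int_binomial 1 (Suc 0) = 1" "int_binomial 1 (Suc (Suc k)) = 0"
proof -
  show "int_binomial 1 (Suc 0) = 1"
    by (simp add: int_binomial_def)
  have "(\<Prod>l = 0..<Suc (Suc k). 1 - int l) = 0"
    by (rule prod_zero) (auto intro: bexI[of _ 1])
  then show "int_binomial 1 (Suc (Suc k)) = 0"
    by (simp only: int_binomial_def) simp
qed

text \<open>Negating the upper index: the factors are -(1 + s + l) for l < k, with absolute product
  (s + k)!/s!. These numbers govern how \<partial>^(-1-s) moves past a function.\<close>

lemma int_binomial_neg: "int_binomial (- 1 - int s) k = (- 1) ^ k * int ((s + k) choose k)"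
proof -
  have "(\<Prod>l = 0..<k. - 1 - int s - int l) = (- 1) ^ k * (fact k * int ((s + k) choose k))"
  proof (induction k)
    case (Suc k)
    have "fact (Suc k) * int ((s + Suc k) choose Suc k)
        = int (fact k * (Suc k * (Suc (s + k) choose Suc k)))"
      by (simp add: algebra_simps)
    also have "\<dots> = int (fact k * (Suc (s + k) * ((s + k) choose k)))"
      by (simp only: Suc_times_binomial_eq[symmetric] Suc_times_binomial mult.commute)
    finally have "fact (Suc k) * int ((s + Suc k) choose Suc k)
        = fact k * int ((s + k) choose k) * (1 + int s + int k)"
      by (simp add: algebra_simps)
    with Suc show ?case
      by (simp add: algebra_simps)
  qed simp
  then show ?thesis
    by (simp add: int_binomial_def mult.left_commute)
qed

context differential_algebra
begin

section \<open>The derivation and its antiderivative\<close>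

lemma derivation_0 [simp]: "\<partial> 0 = 0"
  using derivation_add[of 0 0] by simp

lemma derivation_minus: "\<partial> (- f) = - \<partial> f"
  using derivation_add[of f "- f"] by (simp add: eq_neg_iff_add_eq_0 add.commute)

lemma derivation_diff: "\<partial> (f - g) = \<partial> f - \<partial> g"
  using derivation_add[of f "- g"] by (simp add: derivation_minus)

lemma derivation_sum: "\<partial> (sum f A) = (\<Sum>x\<in>A. \<partial> (f x))"
  by (induction A rule: infinite_finite_induct) (simp_all add: derivation_add)

lemma derivation_antiderivative [simp]: "\<partial> (\<integral> f) = f"
  using bij_derivation by (simp add: bij_is_surj surj_f_inv_f)

lemma antiderivative_derivation [simp]: "\<integral> (\<partial> f) = f"
  using bij_derivation by (simp add: bij_is_inj)

text \<open>Bijectivity of \<partial> leaves no integration constant, so the rules for \<integral>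
  below are checked by differentiating.\<close>

lemma antiderivative_eqI: "\<partial> g = f \<Longrightarrow> \<integral> f = g"
  by auto

lemma antiderivative_add: "\<integral> (f + g) = \<integral> f + \<integral> g"
  by (rule antiderivative_eqI) (simp add: derivation_add)

lemma antiderivative_diff: "\<integral> (f - g) = \<integral> f - \<integral> g"
  by (rule antiderivative_eqI) (simp add: derivation_diff)

lemma antiderivative_sum: "\<integral> (sum f A) = (\<Sum>x\<in>A. \<integral> (f x))"
  by (rule antiderivative_eqI) (simp add: derivation_sum)

lemma antiderivative_scale: "\<integral> (c *s f) = c *s \<integral> f"
  by (rule antiderivative_eqI) (simp add: derivation_scale)

lemma antiderivative_by_parts: "\<integral> (f * \<integral> g) = \<integral> f * \<integral> g - \<integral> (\<integral> f * g)"
  by (rule antiderivative_eqI) (simp add: derivation_diff derivation_mult)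

lemma scale_mult_right: "f * (c *s g) = c *s (f * g)"
  by (metis mult.commute scale_mult_left)

lemma scale_two: "2 *s f = f + f"
  using scale_left_distrib[of 1 1 f] by simp

lemma scale_three: "3 *s f = f + f + f"
  using scale_left_distrib[of 2 1 f] by (simp add: scale_two)

text \<open>The formal adjoint of \<partial>; its powers are the coefficients in the expansion of
  \<partial>^(-1) composed with a function.\<close>

definition neg_deriv :: "'a \<Rightarrow> 'a"
  where "neg_deriv f = - \<partial> f"

lemma neg_deriv_add: "(neg_deriv ^^ k) (f + g) = (neg_deriv ^^ k) f + (neg_deriv ^^ k) g"
  by (induction k) (simp_all add: neg_deriv_def derivation_add)

lemma neg_deriv_0 [simp]: "(neg_deriv ^^ k) 0 = 0"
  by (induction k) (simp_all add: neg_deriv_def)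

lemma neg_deriv_minus: "(neg_deriv ^^ k) (- f) = - (neg_deriv ^^ k) f"
  by (induction k) (simp_all add: neg_deriv_def derivation_minus)

lemma neg_deriv_diff: "(neg_deriv ^^ k) (f - g) = (neg_deriv ^^ k) f - (neg_deriv ^^ k) g"
  using neg_deriv_add[of k f "- g"] by (simp add: neg_deriv_minus)

lemma neg_deriv_funpow: "(neg_deriv ^^ k) f = (- 1) ^ k *s (\<partial> ^^ k) f"
  by (induction k) (simp_all add: neg_deriv_def derivation_scale)

section \<open>Coefficients acting on functions\<close>

lemma coeff_act_0_left [simp]: "coeff_act 0 f = 0"
  by (simp add: zero_prod_def)

lemma coeff_act_add_left: "coeff_act (x + y) f = coeff_act x f + coeff_act y f"
  by (cases x; cases y) (simp add: scale_left_distrib algebra_simps)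

lemma coeff_act_add_right: "coeff_act x (f + g) = coeff_act x f + coeff_act x g"
  by (cases x) (simp add: scale_right_distrib algebra_simps)

lemma coeff_act_deriv: "coeff_act (coeff_deriv x) f = \<partial> (coeff_act x f) - coeff_act x (\<partial> f)"
  by (cases x) (simp add: derivation_add derivation_scale derivation_mult)

lemma coeff_act_mult: "coeff_act x f * g = f * coeff_act x g"
  by (cases x) (simp add: algebra_simps scale_mult_left scale_mult_right)

lemma coeff_deriv_0 [simp]: "coeff_deriv 0 = 0"
  by (simp add: zero_prod_def)

lemma coeff_deriv_funpow_0 [simp]: "(coeff_deriv ^^ k) 0 = 0"
  by (induction k) simp_all

lemma coeff_deriv_one: "(coeff_deriv ^^ k) (1, 0) = (if k = 0 then (1, 0) else 0)"
proof (induction k)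
  case (Suc k)
  then show ?case by (cases k) (simp_all add: zero_prod_def)
qed simp

lemma coeff_mult_0_left [simp]: "coeff_mult 0 x = 0"
  by (cases x) (simp add: zero_prod_def)

lemma coeff_mult_0_right [simp]: "coeff_mult x 0 = 0"
  by (cases x) (simp add: zero_prod_def)

lemma coeff_mult_one [simp]: "coeff_mult (1, 0) x = x"
  by (cases x) simp

lemma coeff_mult_fun: "coeff_mult (0, g) x = (0, coeff_act x g)"
  by (cases x) (simp add: mult.commute)

section \<open>Coefficients of products\<close>

lemma product_term_0 [simp]:
  "p i = 0 \<Longrightarrow> product_term p q i j k = 0"
  "q j = 0 \<Longrightarrow> product_term p q i j k = 0"
  by (simp_all add: product_term_def)

text \<open>Enlarging the index set from the supports to ranges given by order bounds adds only zero
  terms, and the ranges allow summation one right-hand coefficient at a time.\<close>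

lemma coeff_pdo_mult:
  assumes "\<And>i. M < i \<Longrightarrow> coeff P i = 0" and "\<And>j. N < j \<Longrightarrow> coeff Q j = 0"
  shows "coeff (P \<odot> Q) n
    = (\<Sum>j\<in>{n - M..N}. \<Sum>i\<in>{n - j..M}. product_term (coeff P) (coeff Q) i j (nat (i + j - n)))"
proof -
  let ?t = "\<lambda>i j. product_term (coeff P) (coeff Q) i j (nat (i + j - n))"
  let ?S = "SIGMA j:{n - M..N}. {n - j..M}"
  have "(\<Sum>j\<in>{n - M..N}. \<Sum>i\<in>{n - j..M}. ?t i j) = (\<Sum>(j, i)\<in>?S. ?t i j)"
    by (simp add: sum.Sigma)
  also have "\<dots> = (\<Sum>(i, j)\<in>prod.swap ` ?S. ?t i j)"
    by (subst sum.reindex) (auto intro: sum.cong)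
  also have "\<dots> = (\<Sum>(i, j)\<in>{(i, j). coeff P i \<noteq> 0 \<and> coeff Q j \<noteq> 0 \<and> n \<le> i + j}. ?t i j)"
  proof (rule sum.mono_neutral_right)
    have "\<And>i j. coeff P i \<noteq> 0 \<Longrightarrow> coeff Q j \<noteq> 0 \<Longrightarrow> i \<le> M \<and> j \<le> N"
      using assms by (meson not_le)
    then show "{(i, j). coeff P i \<noteq> 0 \<and> coeff Q j \<noteq> 0 \<and> n \<le> i + j} \<subseteq> prod.swap ` ?S"
      by (fastforce simp: image_iff)
  qed (auto simp: prod.swap_def)
  finally show ?thesis
    by (simp add: pdo_mult.rep_eq)
qed

lemma coeff_monomial: "coeff (monomial a n) i = (if i = n then a else 0)"
  by (simp add: monomial.rep_eq)

lemma coeff_monomial_mult: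
  "coeff (monomial a i \<odot> monomial b j) n
    = (if n \<le> i + j then coeff_mult (of_int (int_binomial i (nat (i + j - n))), 0)
         (coeff_mult a ((coeff_deriv ^^ nat (i + j - n)) b)) else 0)"
proof -
  let ?t = "\<lambda>i' j'. product_term (coeff (monomial a i)) (coeff (monomial b j)) i' j' (nat (i' + j' - n))"
  have "coeff (monomial a i \<odot> monomial b j) n
      = (\<Sum>j'\<in>{n - i..j}. \<Sum>i'\<in>{n - j'..i}. ?t i' j')"
    by (rule coeff_pdo_mult) (simp_all add: coeff_monomial)
  also have "\<dots> = (\<Sum>j'\<in>{n - i..j}. if j' = j then (\<Sum>i'\<in>{n - j'..i}. ?t i' j') else 0)"
    by (rule sum.cong) (auto simp: coeff_monomial)
  also have "\<dots> = (if n \<le> i + j then (\<Sum>i'\<in>{n - j..i}. ?t i' j) else 0)"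
    by (simp add: sum.delta)
  also have "(\<Sum>i'\<in>{n - j..i}. ?t i' j) = (\<Sum>i'\<in>{n - j..i}. if i' = i then ?t i' j else 0)"
    by (rule sum.cong) (auto simp: coeff_monomial)
  finally show ?thesis
    by (auto simp: sum.delta product_term_def coeff_monomial)
qed

text \<open>The binomial of -1 over k is (-1)^k, so the term of \<partial>^(-1) g of order -1-k has
  coefficient (-\<partial>)^k g.\<close>

lemma fun_integral_fun_eq:
  "coeff (mult_by f \<odot> D_pow (-1) \<odot> mult_by g) n
    = (if n < 0 then (0, f * (neg_deriv ^^ nat (- 1 - n)) g) else 0)"
proof -
  have "mult_by f \<odot> D_pow (-1) = monomial (0, f) (- 1)"
    by (rule coeff_inject[THEN iffD1], rule ext)
       (auto simp: coeff_monomial_mult coeff_deriv_one coeff_monomial)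
  moreover have "(coeff_deriv ^^ k) (0, g) = (0, (\<partial> ^^ k) g)" for k
    by (induction k) simp_all
  ultimately show ?thesis
    using int_binomial_neg[of 0 "nat (- 1 - n)"]
    by (auto simp: coeff_monomial_mult neg_deriv_funpow scale_mult_right)
qed

lemma coeff_plus: "coeff (P + Q) n = coeff P n + coeff Q n"
  by (simp add: plus_pdo.rep_eq)

lemma coeff_lax:
  "coeff (lax q r) n = (if n = 1 then (1, 0) else if n < 0 then
     (0, q * (neg_deriv ^^ nat (- 1 - n)) r + r * (neg_deriv ^^ nat (- 1 - n)) q) else 0)"
  by (auto simp: lax_def coeff_plus fun_integral_fun_eq coeff_monomial)

lemma leibniz:
  "(\<partial> ^^ n) (coeff_act x g)
    = (\<Sum>k\<le>n. of_nat (n choose k) *s coeff_act ((coeff_deriv ^^ k) x) ((\<partial> ^^ (n - k)) g))"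
proof (induction n)
  case (Suc n)
  let ?T = "\<lambda>k l. coeff_act ((coeff_deriv ^^ k) x) ((\<partial> ^^ l) g)"
  have "\<partial> (of_nat (n choose k) *s ?T k (n - k))
      = of_nat (n choose k) *s ?T (Suc k) (n - k) + of_nat (n choose k) *s ?T k (Suc n - k)"
    if "k \<le> n" for k
    using that
    by (simp add: derivation_scale coeff_act_deriv Suc_diff_le flip: scale_right_distrib)
  then have "(\<partial> ^^ Suc n) (coeff_act x g)
      = (\<Sum>k\<le>n. of_nat (n choose k) *s ?T (Suc k) (n - k))
      + (\<Sum>k\<le>n. of_nat (n choose k) *s ?T k (Suc n - k))"
    using Suc by (simp add: derivation_sum flip: sum.distrib)
  also have "(\<Sum>k\<le>n. of_nat (n choose k) *s ?T k (Suc n - k))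
      = (\<Sum>k\<le>Suc n. of_nat (n choose k) *s ?T k (Suc n - k))"
    by (simp add: binomial_eq_0)
  also have "\<dots> = ?T 0 (Suc n) + (\<Sum>k\<le>n. of_nat (n choose Suc k) *s ?T (Suc k) (n - k))"
    by (subst sum.atMost_Suc_shift) simp
  also have "(\<Sum>k\<le>n. of_nat (n choose k) *s ?T (Suc k) (n - k))
        + (?T 0 (Suc n) + (\<Sum>k\<le>n. of_nat (n choose Suc k) *s ?T (Suc k) (n - k)))
      = ?T 0 (Suc n) + (\<Sum>k\<le>n. of_nat (Suc n choose Suc k) *s ?T (Suc k) (n - k))"
    by (simp add: sum.distrib scale_left_distrib add.left_commute)
  also have "\<dots> = (\<Sum>k\<le>Suc n. of_nat (Suc n choose k) *s ?T k (Suc n - k))"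
    by (subst sum.atMost_Suc_shift) simp
  finally show ?case .
qed simp

text \<open>The Leibniz rule sorted by the derivatives falling on \<open>g\<close>. Its coefficients
  are the binomials of -1-s over n-s, in the form in which \<open>lax_mult_column\<close> produces
  them.\<close>

lemma neg_deriv_leibniz:
  "(neg_deriv ^^ n) (coeff_act x g) = (\<Sum>s\<le>n. ((- 1) ^ (n - s) * of_nat (n choose (n - s))) *s
      coeff_act ((coeff_deriv ^^ (n - s)) x) ((neg_deriv ^^ s) g))"
proof -
  have act: "coeff_act y (c *s f) = c *s coeff_act y f" for y c f
    by (cases y) (simp add: scale_right_distrib mult.commute scale_mult_right)
  have pow: "(- 1) ^ (n - s) * (- 1) ^ s = ((- 1) ^ n :: 'k)" if "s \<le> n" for s
    using that by (simp flip: power_add)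
  have "(neg_deriv ^^ n) (coeff_act x g)
      = (\<Sum>k\<le>n. ((- 1) ^ n * of_nat (n choose k)) *s
          coeff_act ((coeff_deriv ^^ k) x) ((\<partial> ^^ (n - k)) g))"
    by (simp add: neg_deriv_funpow leibniz scale_sum_right)
  also have "\<dots> = (\<Sum>s\<le>n. ((- 1) ^ n * of_nat (n choose (n - s))) *s
          coeff_act ((coeff_deriv ^^ (n - s)) x) ((\<partial> ^^ s) g))"
    unfolding atMost_atLeast0
    by (subst sum.atLeastAtMost_rev) (auto intro: sum.cong)
  also have "\<dots> = (\<Sum>s\<le>n. ((- 1) ^ (n - s) * of_nat (n choose (n - s))) *s
      coeff_act ((coeff_deriv ^^ (n - s)) x) ((neg_deriv ^^ s) g))"
    by (rule sum.cong) (auto simp: neg_deriv_funpow act ac_simps simp flip: pow)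
  finally show ?thesis .
qed

section \<open>Left multiplication by the Lax operator\<close>

lemma coeff_act_times: "coeff_act x (f * g) = f * coeff_act x g"
  by (cases x) (simp add: algebra_simps scale_mult_right)

lemma sum_Pair_0: "(\<Sum>x\<in>A. (0, f x)) = (0, sum f A)"
  by (induction A rule: infinite_finite_induct) (simp_all add: zero_prod_def)

text \<open>The coefficient of order \<open>n\<close> of \<open>\<partial>\<^bsup>-1\<^esup> \<circ> g \<circ> P\<close>.\<close>

definition tail :: "('k, 'a) pdo \<Rightarrow> 'a \<Rightarrow> int \<Rightarrow> 'a"
  where "tail P g n
    = (\<Sum>j | n < j \<and> coeff P j \<noteq> 0. (neg_deriv ^^ nat (j - n - 1)) (coeff_act (coeff P j) g))"

lemma tail_eq:
  assumes "\<And>i. N < i \<Longrightarrow> coeff P i = 0"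
  shows "tail P g n = (\<Sum>j\<in>{n<..N}. (neg_deriv ^^ nat (j - n - 1)) (coeff_act (coeff P j) g))"
  unfolding tail_def using assms
  by (intro sum.mono_neutral_left) (auto simp: not_less[symmetric])

lemma pdo_bound:
  obtains N :: int where "n \<le> N" and "\<And>i. N < i \<Longrightarrow> coeff P i = 0"
proof -
  obtain N where "\<forall>i>N. coeff P i = 0"
    using coeff[of P] by auto
  then show ?thesis
    using that[of "max n N"] by simp
qed

text \<open>Collects what a single right-hand coefficient \<open>p j\<close> contributes to order
  \<open>j + 1 - J\<close>. The summand \<partial> of the Lax operator accounts for \<open>J\<close>
  = 0 and 1; the contributions of its integral terms recombine by the Leibniz rule.\<close>

lemma lax_mult_column:
  fixes J :: nat
  shows "(\<Sum>i\<in>{1 - int J..1}. product_term (coeff (lax q r)) p i j (nat (i + int J - 1)))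
    = (case J of 0 \<Rightarrow> p j | Suc 0 \<Rightarrow> coeff_deriv (p j)
        | Suc (Suc w) \<Rightarrow> (0, q * (neg_deriv ^^ w) (coeff_act (p j) r) + r * (neg_deriv ^^ w) (coeff_act (p j) q)))"
proof -
  let ?t = "\<lambda>t. product_term (coeff (lax q r)) p (1 - int t) j (J - t)"
  have "(\<Sum>i\<in>{1 - int J..1}. product_term (coeff (lax q r)) p i j (nat (i + int J - 1)))
      = (\<Sum>t\<le>J. ?t t)"
    by (rule sum.reindex_bij_witness[of _ "\<lambda>t. 1 - int t" "\<lambda>i. nat (1 - i)"])
       (auto simp: nat_diff_distrib' intro!: arg_cong[of _ _ "product_term _ _ _ _"])
  also have "\<dots> = (case J of 0 \<Rightarrow> p j | Suc 0 \<Rightarrow> coeff_deriv (p j)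
        | Suc (Suc w) \<Rightarrow> (0, q * (neg_deriv ^^ w) (coeff_act (p j) r) + r * (neg_deriv ^^ w) (coeff_act (p j) q)))"
  proof (cases J)
    case 0
    then show ?thesis
      by (simp add: product_term_def coeff_lax)
  next
    case J: (Suc J')
    show ?thesis
    proof (cases J')
      case 0
      with J show ?thesis
        by (simp add: product_term_def coeff_lax int_binomial_one)
    next
      case (Suc w)
      \<comment> \<open>Here \<open>t\<close> = s + 2 belongs to order -1-s of the Lax operator, and
        \<open>J - t\<close> is w - s.\<close>
      have "?t (Suc (Suc s)) = (0,
            q * (((- 1) ^ (w - s) * of_nat (w choose (w - s))) *s
              coeff_act ((coeff_deriv ^^ (w - s)) (p j)) ((neg_deriv ^^ s) r))
          + r * (((- 1) ^ (w - s) * of_nat (w choose (w - s))) *s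
              coeff_act ((coeff_deriv ^^ (w - s)) (p j)) ((neg_deriv ^^ s) q)))"
        if "s \<le> w" for s
        using that Suc J int_binomial_neg[of s "w - s"]
        by (simp add: product_term_def coeff_lax coeff_mult_fun coeff_act_add_right coeff_act_times
            scale_right_distrib scale_mult_right)
      \<comment> \<open>For \<open>t\<close> = 0 the binomial of 1 over \<open>J\<close> \<ge> 2
        vanishes; for \<open>t\<close> = 1 the Lax operator has no coefficient of order
        zero.\<close>
      moreover have "?t 0 = 0" "?t (Suc 0) = 0"
        using Suc J by (simp_all add: product_term_def coeff_lax int_binomial_one flip: zero_prod_def)
      moreover have "(\<Sum>t\<le>J. ?t t) = ?t 0 + (?t (Suc 0) + (\<Sum>s\<le>w. ?t (Suc (Suc s))))"
        unfolding J Suc by (simp only: sum.atMost_Suc_shift)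
      ultimately show ?thesis
        using J Suc by (simp add: sum_Pair_0 sum.distrib neg_deriv_leibniz flip: sum_distrib_left)
    qed
  qed
  finally show ?thesis .
qed

lemma coeff_lax_mult:
  "coeff (lax q r \<odot> P) n
    = coeff_deriv (coeff P n) + coeff P (n - 1) + (0, q * tail P r n + r * tail P q n)"
proof -
  obtain N where N: "n \<le> N" "\<And>i. N < i \<Longrightarrow> coeff P i = 0"
    using pdo_bound[of n P] by blast
  let ?e = "\<lambda>g j. (neg_deriv ^^ nat (j - n - 1)) (coeff_act (coeff P j) g)"
  let ?c = "\<lambda>j. \<Sum>i\<in>{n - j..1}. product_term (coeff (lax q r)) (coeff P) i j (nat (i + j - n))"
  have column: "?c j = (case nat (j + 1 - n) of 0 \<Rightarrow> coeff P j | Suc 0 \<Rightarrow> coeff_deriv (coeff P j)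
        | Suc (Suc w) \<Rightarrow> (0, q * (neg_deriv ^^ w) (coeff_act (coeff P j) r)
            + r * (neg_deriv ^^ w) (coeff_act (coeff P j) q)))" if "n - 1 \<le> j" for j
  proof -
    have J: "1 - int (nat (j + 1 - n)) = n - j" "i + int (nat (j + 1 - n)) - 1 = i + j - n" for i
      using that by simp_all
    show ?thesis
      using lax_mult_column[where J = "nat (j + 1 - n)" and p = "coeff P" and j = j]
      unfolding J .
  qed
  have "coeff (lax q r \<odot> P) n = (\<Sum>j\<in>{n - 1..N}. ?c j)"
    using N by (intro coeff_pdo_mult) (simp_all add: coeff_lax)
  \<comment> \<open>The columns n - 1 and n come from \<partial>, the columns above n from the
    integral terms.\<close>
  also have "{n - 1..N} = insert (n - 1) (insert n {n<..N})"
    using N(1) by auto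
  also have "(\<Sum>j\<in>\<dots>. ?c j) = ?c (n - 1) + (?c n + (\<Sum>j\<in>{n<..N}. ?c j))"
    by (simp del: sum.cong)
  also have "?c (n - 1) = coeff P (n - 1)"
    using column[of "n - 1"] by simp
  also have "?c n = coeff_deriv (coeff P n)"
    using column[of n] by simp
  also have "(\<Sum>j\<in>{n<..N}. ?c j) = (\<Sum>j\<in>{n<..N}. (0, q * ?e r j + r * ?e q j))"
  proof (rule sum.cong)
    fix j assume "j \<in> {n<..N}"
    then have "nat (j + 1 - n) = Suc (Suc (nat (j - n - 1)))" and "n - 1 \<le> j"
      by auto
    with column[of j] show "?c j = (0, q * ?e r j + r * ?e q j)"
      by simp
  qed simp
  also have "\<dots> = (0, q * tail P r n + r * tail P q n)"
    by (simp add: sum_Pair_0 sum.distrib sum_distrib_left tail_eq[OF N(2)])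
  finally show ?thesis
    by (simp add: add.assoc add.left_commute)
qed

text \<open>With T = \<partial>^(-1) g P, this compares the coefficients of order n in \<partial> T
  = g P.\<close>

lemma tail_step: "tail P g (n - 1) = coeff_act (coeff P n) g - \<partial> (tail P g n)"
proof -
  obtain N where N: "n \<le> N" "\<And>i. N < i \<Longrightarrow> coeff P i = 0"
    using pdo_bound[of n P] by blast
  let ?e = "\<lambda>n j. (neg_deriv ^^ nat (j - n - 1)) (coeff_act (coeff P j) g)"
  have "{n - 1<..N} = insert n {n<..N}"
    using N(1) by auto
  then have "tail P g (n - 1) = coeff_act (coeff P n) g + (\<Sum>j\<in>{n<..N}. ?e (n - 1) j)"
    by (simp add: tail_eq[OF N(2)])
  also have "(\<Sum>j\<in>{n<..N}. ?e (n - 1) j) = (\<Sum>j\<in>{n<..N}. - \<partial> (?e n j))"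
  proof (rule sum.cong)
    fix j assume "j \<in> {n<..N}"
    then have "nat (j - (n - 1) - 1) = Suc (nat (j - n - 1))"
      by auto
    then show "?e (n - 1) j = - \<partial> (?e n j)"
      by (simp add: neg_deriv_def)
  qed simp
  finally show ?thesis
    by (simp add: derivation_sum sum_negf tail_eq[OF N(2)])
qed

section \<open>Differential parts, their action and their adjoints\<close>

lemma pdo_bound_nat:
  obtains N :: nat where "\<And>i. int N \<le> i \<Longrightarrow> coeff P i = 0"
proof -
  obtain N where "0 \<le> N" and N: "\<And>i. N < i \<Longrightarrow> coeff P i = 0"
    using pdo_bound[of 0 P] by blast
  then show ?thesis
    by (intro that[of "nat (N + 1)"]) simp
qed

lemma tail_eq_0: "(\<And>i. n < i \<Longrightarrow> coeff P i = 0) \<Longrightarrow> tail P g n = 0"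
  by (auto simp: tail_def intro!: sum.neutral)

lemma pdo_apply_eq:
  assumes "\<And>i. int N \<le> i \<Longrightarrow> coeff P i = 0"
  shows "pdo_apply P f = (\<Sum>n<N. coeff_act (coeff P (int n)) ((\<partial> ^^ n) f))"
proof -
  have "pdo_apply P f = (\<Sum>i\<in>{0..<int N}. coeff_act (coeff P i) ((\<partial> ^^ nat i) f))"
    unfolding pdo_apply_def using assms
    by (intro sum.mono_neutral_left) (auto simp: not_le[symmetric])
  also have "\<dots> = (\<Sum>n<N. coeff_act (coeff P (int n)) ((\<partial> ^^ n) f))"
    by (rule sum.reindex_bij_witness[of _ int nat]) auto
  finally show ?thesis .
qed

text \<open>The formal adjoint of the differential part of \<open>P\<close>, applied to a function.\<close>

definition adj_apply :: "('k, 'a) pdo \<Rightarrow> 'a \<Rightarrow> 'a"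
  where "adj_apply P f = tail P f (- 1)"

text \<open>At order -1 the exponent j - n - 1 in \<open>tail\<close> is j itself and exactly the
  orders j \<ge> 0 occur, which gives the usual sum for the adjoint.\<close>

lemma adj_apply_eq:
  assumes "\<And>i. int N \<le> i \<Longrightarrow> coeff P i = 0"
  shows "adj_apply P f = (\<Sum>n<N. (neg_deriv ^^ n) (coeff_act (coeff P (int n)) f))"
proof -
  have "adj_apply P f
      = (\<Sum>j\<in>{-1<..int N - 1}. (neg_deriv ^^ nat (j - (- 1) - 1)) (coeff_act (coeff P j) f))"
    unfolding adj_apply_def using assms by (intro tail_eq) simp
  also have "\<dots> = (\<Sum>n<N. (neg_deriv ^^ n) (coeff_act (coeff P (int n)) f))"
    by (rule sum.reindex_bij_witness[of _ int nat]) auto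
  finally show ?thesis .
qed

lemma adj_apply_add: "adj_apply P (f + g) = adj_apply P f + adj_apply P g"
  by (simp add: adj_apply_def tail_def coeff_act_add_right neg_deriv_add sum.distrib)

text \<open>Lagrange's identity: the tails are the coefficients of the bilinear expression whose
  derivative is g P(f) minus the adjoint of P at g times f, for the differential part of P. By
  \<open>tail_step\<close> the partial sums telescope up to a boundary term.\<close>

lemma tail_telescope:
  "\<partial> (\<Sum>n<N. tail P g (int n) * (\<partial> ^^ n) f)
    = (\<Sum>n<N. g * coeff_act (coeff P (int n)) ((\<partial> ^^ n) f))
      - adj_apply P g * f + tail P g (int N - 1) * (\<partial> ^^ N) f"
proof (induction N)
  case (Suc N)
  then show ?case
    using tail_step[of P g "int N"] coeff_act_mult[of "coeff P (int N)" g "(\<partial> ^^ N) f"]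
    by (simp add: derivation_add derivation_mult algebra_simps)
qed (simp add: adj_apply_def)

text \<open>The left side is the differential part of \<partial>^(-1) g P acting on f. The boundary
  term of Lagrange's identity vanishes beyond the order of P.\<close>

lemma sum_tail_apply:
  assumes "\<And>i. int N \<le> i \<Longrightarrow> coeff P i = 0"
  shows "(\<Sum>n<N. tail P g (int n) * (\<partial> ^^ n) f)
    = \<integral> (g * pdo_apply P f) - \<integral> (adj_apply P g * f)"
proof -
  have "tail P g (int N - 1) = 0"
    using assms by (intro tail_eq_0) simp
  then have "\<partial> (\<Sum>n<N. tail P g (int n) * (\<partial> ^^ n) f) = g * pdo_apply P f - adj_apply P g * f"
    by (simp add: tail_telescope pdo_apply_eq[OF assms] sum_distrib_left)
  then show ?thesis
    by (metis antiderivative_derivation antiderivative_diff)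
qed

text \<open>By the product rule and \<open>tail_step\<close>, each \<partial> h times a tail is a
  difference of consecutive boundary terms minus a term of the adjoint of P.\<close>

lemma tail_adjoint_telescope:
  "(\<Sum>n<N. (neg_deriv ^^ n) (\<partial> h * tail P g (int n)))
    = h * adj_apply P g - (\<Sum>n<N. (neg_deriv ^^ n) (coeff_act (coeff P (int n)) (g * h)))
      - (neg_deriv ^^ N) (h * tail P g (int N - 1))"
proof (induction N)
  case (Suc N)
  have "\<partial> h * tail P g (int N)
      = h * tail P g (int N - 1) - coeff_act (coeff P (int N)) (g * h) - neg_deriv (h * tail P g (int N))"
  proof -
    have "coeff_act (coeff P (int N)) (g * h) = h * (tail P g (int N - 1) + \<partial> (tail P g (int N)))"
      by (simp add: tail_step coeff_act_times mult.commute[of g])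
    then show ?thesis
      by (simp add: derivation_mult neg_deriv_def algebra_simps)
  qed
  with Suc show ?case
    by (simp add: neg_deriv_diff flip: funpow_Suc_right[THEN fun_cong, unfolded o_def])
qed (simp add: adj_apply_def)

lemma sum_tail_adjoint:
  assumes "\<And>i. int N \<le> i \<Longrightarrow> coeff P i = 0"
  shows "(\<Sum>n<N. (neg_deriv ^^ n) (f * tail P g (int n)))
    = \<integral> f * adj_apply P g - adj_apply P (g * \<integral> f)"
proof -
  have "tail P g (int N - 1) = 0"
    using assms by (intro tail_eq_0) simp
  then show ?thesis
    \<comment> \<open>The choice h = \<integral> f makes \<partial> h equal to f.\<close>
    using tail_adjoint_telescope[where h = "\<integral> f" and N = N and P = P and g = g]
    by (simp add: adj_apply_eq[OF assms])
qed

lemma coeff_act_lax_mult: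
  "coeff_act (coeff (lax q r \<odot> P) n) f
    = \<partial> (coeff_act (coeff P n) f) - coeff_act (coeff P n) (\<partial> f) + coeff_act (coeff P (n - 1)) f
      + q * f * tail P r n + r * f * tail P q n"
  by (simp add: coeff_lax_mult coeff_act_add_left coeff_act_deriv algebra_simps)

text \<open>One bound serves both operators; the extra zero at order N - 1 removes the upper end of
  the telescoping sums below.\<close>

lemma lax_mult_bound:
  fixes P :: "('k, 'a) pdo"
  obtains N where "\<And>i. int N \<le> i \<Longrightarrow> coeff P i = 0"
    and "\<And>i. int N \<le> i \<Longrightarrow> coeff (lax q r \<odot> P) i = 0" and "coeff P (int N - 1) = 0"
proof -
  obtain M where M: "\<And>i. int M \<le> i \<Longrightarrow> coeff P i = 0"
    using pdo_bound_nat by blast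
  obtain N where N: "\<And>i. int N \<le> i \<Longrightarrow> coeff (lax q r \<odot> P) i = 0"
    using pdo_bound_nat by blast
  show ?thesis
    using M N by (intro that[of "max (Suc M) N"]) auto
qed

text \<open>Multiplying by \<partial> lifts the coefficient of order -1 into the differential part,
  and \<open>sum_tail_apply\<close> gives the differential part of the integral terms times
  P.\<close>

lemma pdo_apply_lax_mult:
  "pdo_apply (lax q r \<odot> P) f = lax_fun q r (pdo_apply P f) + coeff_act (coeff P (- 1)) f
    - q * \<integral> (adj_apply P r * f) - r * \<integral> (adj_apply P q * f)"
proof -
  obtain N where P: "\<And>i. int N \<le> i \<Longrightarrow> coeff P i = 0"
    and LP: "\<And>i. int N \<le> i \<Longrightarrow> coeff (lax q r \<odot> P) i = 0" and last: "coeff P (int N - 1) = 0"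
    using lax_mult_bound[of P q r] by blast
  \<comment> \<open>The terms with coefficients n and n - 1 in \<open>coeff_act_lax_mult\<close>
    form differences of \<open>?s\<close>, so only the value at n = 0 survives.\<close>
  let ?s = "\<lambda>n. coeff_act (coeff P (int n - 1)) ((\<partial> ^^ n) f)"
  have "(\<Sum>n<N. ?s n - ?s (Suc n)) = coeff_act (coeff P (- 1)) f"
    using sum_lessThan_telescope'[of ?s N] last by simp
  moreover have "pdo_apply (lax q r \<odot> P) f = \<partial> (\<Sum>n<N. coeff_act (coeff P (int n)) ((\<partial> ^^ n) f))
      + (\<Sum>n<N. ?s n - ?s (Suc n)) + q * (\<Sum>n<N. tail P r (int n) * (\<partial> ^^ n) f)
      + r * (\<Sum>n<N. tail P q (int n) * (\<partial> ^^ n) f)"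
    by (simp add: pdo_apply_eq[OF LP] coeff_act_lax_mult sum.distrib sum_subtractf derivation_sum
        sum_distrib_left ac_simps algebra_simps)
  moreover have "(\<Sum>n<N. tail P g (int n) * (\<partial> ^^ n) f)
      = \<integral> (g * pdo_apply P f) - \<integral> (adj_apply P g * f)" for g
    using P by (rule sum_tail_apply)
  moreover have "(\<Sum>n<N. coeff_act (coeff P (int n)) ((\<partial> ^^ n) f)) = pdo_apply P f"
    using P by (rule pdo_apply_eq[symmetric])
  ultimately have "pdo_apply (lax q r \<odot> P) f
      = \<partial> (pdo_apply P f) + coeff_act (coeff P (- 1)) f
        + q * (\<integral> (r * pdo_apply P f) - \<integral> (adj_apply P r * f))
        + r * (\<integral> (q * pdo_apply P f) - \<integral> (adj_apply P q * f))"
    by (simp only:)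
  then show ?thesis
    by (simp add: lax_fun_def algebra_simps)
qed

lemma adj_apply_lax_mult:
  "adj_apply (lax q r \<odot> P) f = coeff_act (coeff P (- 1)) f - adj_apply P (\<partial> f)
    + (\<integral> (q * f) * adj_apply P r - adj_apply P (r * \<integral> (q * f)))
    + (\<integral> (r * f) * adj_apply P q - adj_apply P (q * \<integral> (r * f)))"
proof -
  obtain N where P: "\<And>i. int N \<le> i \<Longrightarrow> coeff P i = 0"
    and LP: "\<And>i. int N \<le> i \<Longrightarrow> coeff (lax q r \<odot> P) i = 0" and last: "coeff P (int N - 1) = 0"
    using lax_mult_bound[of P q r] by blast
  let ?s = "\<lambda>n. (neg_deriv ^^ n) (coeff_act (coeff P (int n - 1)) f)"
  have "(\<Sum>n<N. ?s n - ?s (Suc n)) = coeff_act (coeff P (- 1)) f"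
    using sum_lessThan_telescope'[of ?s N] last by simp
  moreover have "adj_apply (lax q r \<odot> P) f = (\<Sum>n<N. ?s n - ?s (Suc n))
      - (\<Sum>n<N. (neg_deriv ^^ n) (coeff_act (coeff P (int n)) (\<partial> f)))
      + (\<Sum>n<N. (neg_deriv ^^ n) (q * f * tail P r (int n)))
      + (\<Sum>n<N. (neg_deriv ^^ n) (r * f * tail P q (int n)))"
  proof -
    have "(neg_deriv ^^ n) (coeff_act (coeff (lax q r \<odot> P) (int n)) f) = ?s n - ?s (Suc n)
        - (neg_deriv ^^ n) (coeff_act (coeff P (int n)) (\<partial> f))
        + (neg_deriv ^^ n) (q * f * tail P r (int n)) + (neg_deriv ^^ n) (r * f * tail P q (int n))" for n
    proof -
      have "(neg_deriv ^^ Suc n) g = - (neg_deriv ^^ n) (\<partial> g)" for g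
        by (simp only: funpow_Suc_right o_apply) (simp add: neg_deriv_def neg_deriv_minus)
      then show ?thesis
        by (simp add: coeff_act_lax_mult neg_deriv_add neg_deriv_diff del: funpow.simps)
    qed
    then show ?thesis
      by (simp add: adj_apply_eq[OF LP] sum.distrib sum_subtractf)
  qed
  ultimately show ?thesis
    by (simp add: sum_tail_adjoint[OF P] adj_apply_eq[OF P, symmetric])
qed

section \<open>The Lax operator acting on functions\<close>

lemma lax_fun_add: "lax_fun q r (f + g) = lax_fun q r f + lax_fun q r g"
  by (simp add: lax_fun_def derivation_add antiderivative_add distrib_left ac_simps)

lemma lax_fun_diff: "lax_fun q r (f - g) = lax_fun q r f - lax_fun q r g"
  using lax_fun_add[of q r "f - g" g] by simp

lemma lax_fun_scale: "lax_fun q r (c *s f) = c *s lax_fun q r f"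
  by (simp add: lax_fun_def derivation_scale antiderivative_scale scale_mult_right
      scale_right_distrib)

lemma lax_fun_swap: "lax_fun r q f = lax_fun q r f"
  by (simp add: lax_fun_def ac_simps)

text \<open>Integration by parts turns the double integrals \<partial>^(-1) h \<partial>^(-1), with
  h = r u or q u, into single ones with the factor \<integral> h.\<close>

lemma lax_fun_times_antiderivative:
  "lax_fun q r (u * \<integral> f)
    = lax_fun q r u * \<integral> f + u * f - q * \<integral> (\<integral> (r * u) * f) - r * \<integral> (\<integral> (q * u) * f)"
proof -
  have parts: "\<integral> (g * (u * \<integral> f)) = \<integral> (g * u) * \<integral> f - \<integral> (\<integral> (g * u) * f)" for g
    using antiderivative_by_parts[of "g * u" f] by (simp add: mult.assoc)
  show ?thesis
    by (simp add: lax_fun_def derivation_mult parts) (simp add: algebra_simps)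
qed

text \<open>Skew-adjointness of L. The integral terms pair up as derivatives of products of two
  antiderivatives.\<close>

lemma lax_fun_skew:
  "u * lax_fun q r v + lax_fun q r u * v
    = \<partial> (u * v + \<integral> (q * u) * \<integral> (r * v) + \<integral> (r * u) * \<integral> (q * v))"
  by (simp add: lax_fun_def derivation_add derivation_mult algebra_simps)

section \<open>Pairs representing the integral part of a power\<close>

definition neg_lax :: "'a \<Rightarrow> 'a \<Rightarrow> 'a \<Rightarrow> 'a"
  where "neg_lax q r f = - lax_fun q r f"

lemma neg_lax_funpow: "(neg_lax q r ^^ k) f = (- 1) ^ k *s (lax_fun q r ^^ k) f"
  by (induction k) (simp_all add: neg_lax_def lax_fun_scale)

text \<open>The integral part of the \<open>m\<close>-th power of the Lax operator is the sum of
  \<open>u \<circ> \<integral> \<circ> v\<close> over the pairs \<open>(u, v)\<close> summed in \<open>lax_pairs q r m\<close>.\<close>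

definition half_pairs :: "'a \<Rightarrow> 'a \<Rightarrow> nat \<Rightarrow> ('a \<Rightarrow> 'a \<Rightarrow> 'a) \<Rightarrow> 'a"
  where "half_pairs q r m \<beta> = (\<Sum>i<m. \<beta> ((lax_fun q r ^^ (m - Suc i)) q) ((neg_lax q r ^^ i) r))"

definition lax_pairs :: "'a \<Rightarrow> 'a \<Rightarrow> nat \<Rightarrow> ('a \<Rightarrow> 'a \<Rightarrow> 'a) \<Rightarrow> 'a"
  where "lax_pairs q r m \<beta> = half_pairs q r m \<beta> + half_pairs r q m \<beta>"

lemma lax_pairs_0 [simp]: "lax_pairs q r 0 \<beta> = 0"
  by (simp add: lax_pairs_def half_pairs_def)

lemma half_pairs_Suc:
  "half_pairs q r (Suc m) \<beta>
    = half_pairs q r m (\<lambda>u. \<beta> (lax_fun q r u)) + \<beta> q ((neg_lax q r ^^ m) r)"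
proof -
  have "(\<Sum>i<m. \<beta> ((lax_fun q r ^^ (m - i)) q) ((neg_lax q r ^^ i) r))
      = half_pairs q r m (\<lambda>u. \<beta> (lax_fun q r u))"
    unfolding half_pairs_def
    by (rule sum.cong) (auto simp flip: funpow.simps(2)[THEN fun_cong, unfolded o_def] simp: Suc_diff_Suc)
  then show ?thesis
    by (simp add: half_pairs_def)
qed

lemma half_pairs_Suc':
  "half_pairs q r (Suc m) \<beta>
    = half_pairs q r m (\<lambda>u v. \<beta> u (neg_lax q r v)) + \<beta> ((lax_fun q r ^^ m) q) r"
  unfolding half_pairs_def by (subst sum.lessThan_Suc_shift) (simp add: add.commute)

lemma lax_fun_swap_fun: "lax_fun r q = lax_fun q r" and neg_lax_swap_fun: "neg_lax r q = neg_lax q r"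
  by (simp_all add: fun_eq_iff lax_fun_swap neg_lax_def)

text \<open>Mirrors splitting off a left factor L: it acts on the left members, and its own integral
  terms create the two new pairs.\<close>

lemma lax_pairs_Suc:
  "lax_pairs q r (Suc m) \<beta> = lax_pairs q r m (\<lambda>u. \<beta> (lax_fun q r u))
    + \<beta> q ((neg_lax q r ^^ m) r) + \<beta> r ((neg_lax q r ^^ m) q)"
  by (simp add: lax_pairs_def half_pairs_Suc lax_fun_swap_fun neg_lax_swap_fun)

text \<open>Mirrors splitting off a right factor L, whose adjoint acts on the right members.
  Equating both splittings yields the derivative of the residue.\<close>

lemma lax_pairs_Suc':
  "lax_pairs q r (Suc m) \<beta> = lax_pairs q r m (\<lambda>u v. \<beta> u (neg_lax q r v))
    + \<beta> ((lax_fun q r ^^ m) q) r + \<beta> ((lax_fun q r ^^ m) r) q"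
  by (simp add: lax_pairs_def half_pairs_Suc' lax_fun_swap_fun neg_lax_swap_fun)

text \<open>Reversing the summation exchanges the exponents i and m - i, and the signs (-1)^i and
  (-1)^(m-i) differ by (-1)^m. Homogeneity of \<beta> lets the signs be pulled out.\<close>

lemma half_pairs_swap:
  assumes "\<And>c u v. \<beta> (c *s u) v = c *s \<beta> u v" and "\<And>c u v. \<beta> u (c *s v) = c *s \<beta> u v"
  shows "half_pairs r q (Suc m) (\<lambda>u v. \<beta> v u) = (- 1) ^ m *s half_pairs q r (Suc m) \<beta>"
proof -
  have "half_pairs r q (Suc m) (\<lambda>u v. \<beta> v u)
      = (\<Sum>i\<le>m. \<beta> ((neg_lax q r ^^ i) q) ((lax_fun q r ^^ (m - i)) r))"
    by (simp add: half_pairs_def lax_fun_swap_fun neg_lax_swap_fun lessThan_Suc_atMost)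
  also have "\<dots> = (\<Sum>i\<le>m. \<beta> ((neg_lax q r ^^ (m - i)) q) ((lax_fun q r ^^ i) r))"
    unfolding atMost_atLeast0
    by (subst sum.atLeastAtMost_rev) (auto intro: sum.cong)
  also have "\<dots> = (\<Sum>i\<le>m. (- 1) ^ m *s \<beta> ((lax_fun q r ^^ (m - i)) q) ((neg_lax q r ^^ i) r))"
  proof (rule sum.cong)
    fix i assume "i \<in> {..m}"
    then have "m = (m - i) + i"
      by simp
    then have "((- 1) ^ m :: 'k) * (- 1) ^ i = (- 1) ^ (m - i) * ((- 1) ^ i * (- 1) ^ i)"
      by (metis power_add mult.assoc)
    then have "((- 1) ^ m :: 'k) * (- 1) ^ i = (- 1) ^ (m - i)"
      by (simp flip: power_mult_distrib)
    then show "\<beta> ((neg_lax q r ^^ (m - i)) q) ((lax_fun q r ^^ i) r)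
        = (- 1) ^ m *s \<beta> ((lax_fun q r ^^ (m - i)) q) ((neg_lax q r ^^ i) r)"
      by (simp add: neg_lax_funpow assms)
  qed simp
  finally show ?thesis
    by (simp add: half_pairs_def lessThan_Suc_atMost scale_sum_right)
qed

lemma lax_pairs_swap:
  assumes "\<And>c u v. \<beta> (c *s u) v = c *s \<beta> u v" and "\<And>c u v. \<beta> u (c *s v) = c *s \<beta> u v"
  shows "lax_pairs q r (Suc m) (\<lambda>u v. \<beta> v u) = (- 1) ^ m *s lax_pairs q r (Suc m) \<beta>"
  using half_pairs_swap[of \<beta> r q m, OF assms] half_pairs_swap[of \<beta> q r m, OF assms]
  by (simp add: lax_pairs_def scale_right_distrib)

lemma lax_pairs_add:
  "lax_pairs q r m (\<lambda>u v. \<beta> u v + \<gamma> u v) = lax_pairs q r m \<beta> + lax_pairs q r m \<gamma>"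
  by (simp add: lax_pairs_def half_pairs_def sum.distrib)

lemma lax_pairs_minus: "lax_pairs q r m (\<lambda>u v. - \<beta> u v) = - lax_pairs q r m \<beta>"
  by (simp add: lax_pairs_def half_pairs_def sum_negf)

lemma lax_pairs_diff:
  "lax_pairs q r m (\<lambda>u v. \<beta> u v - \<gamma> u v) = lax_pairs q r m \<beta> - lax_pairs q r m \<gamma>"
  by (simp add: lax_pairs_def half_pairs_def sum_subtractf)

lemma lax_pairs_cmult: "lax_pairs q r m (\<lambda>u v. f * \<beta> u v) = f * lax_pairs q r m \<beta>"
  by (simp add: lax_pairs_def half_pairs_def sum_distrib_left distrib_left)

lemma lax_pairs_cmult_right: "lax_pairs q r m (\<lambda>u v. \<beta> u v * f) = lax_pairs q r m \<beta> * f"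
  by (simp add: mult.commute[of _ f] lax_pairs_cmult)

lemma lax_pairs_derivation: "lax_pairs q r m (\<lambda>u v. \<partial> (\<beta> u v)) = \<partial> (lax_pairs q r m \<beta>)"
  by (simp add: lax_pairs_def half_pairs_def derivation_sum derivation_add)

lemma lax_pairs_antiderivative: "lax_pairs q r m (\<lambda>u v. \<integral> (\<beta> u v)) = \<integral> (lax_pairs q r m \<beta>)"
  by (simp add: lax_pairs_def half_pairs_def antiderivative_sum antiderivative_add)

lemma lax_pairs_lax_fun: "lax_pairs q r m (\<lambda>u v. lax_fun q r (\<beta> u v)) = lax_fun q r (lax_pairs q r m \<beta>)"
  by (simp add: lax_fun_def lax_pairs_add lax_pairs_derivation lax_pairs_cmult lax_pairs_antiderivative)

text \<open>The claims are proved together because each inductive step uses the residue and the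
  adjoint. The last one has a plus sign since u \<partial>^(-1) v has adjoint -v \<partial>^(-1)
  u.\<close>

lemma lax_power_represented:
  fixes q r :: 'a and m :: nat
  defines "P \<equiv> pdo_power (lax q r) m"
  shows "(\<forall>s. coeff P (- 1 - int s) = (0, lax_pairs q r m (\<lambda>u v. u * (neg_deriv ^^ s) v)))
    \<and> (\<forall>f. pdo_apply P f = (lax_fun q r ^^ m) f - lax_pairs q r m (\<lambda>u v. u * \<integral> (v * f)))
    \<and> (\<forall>f. adj_apply P f = (neg_lax q r ^^ m) f + lax_pairs q r m (\<lambda>u v. \<integral> (f * u) * v))"
  unfolding P_def
proof (induction m)
  case 0
  have "pdo_apply (D_pow 0) f = f" "adj_apply (D_pow 0) f = f" for f
    using pdo_apply_eq[of 1 "D_pow 0" f] adj_apply_eq[of 1 "D_pow 0" f] by (simp_all add: coeff_monomial)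
  then show ?case
    by (simp add: pdo_power_def coeff_monomial zero_prod_def)
next
  case (Suc m)
  let ?P = "pdo_power (lax q r) m"
  let ?S = "lax_pairs q r m (\<lambda>u v. u * v)"
  have neg: "coeff ?P (- 1 - int s) = (0, lax_pairs q r m (\<lambda>u v. u * (neg_deriv ^^ s) v))" for s
    using Suc by blast
  have app: "pdo_apply ?P f = (lax_fun q r ^^ m) f - lax_pairs q r m (\<lambda>u v. u * \<integral> (v * f))" for f
    using Suc by blast
  have adj: "adj_apply ?P f = (neg_lax q r ^^ m) f + lax_pairs q r m (\<lambda>u v. \<integral> (f * u) * v)" for f
    using Suc by blast
  have power: "pdo_power (lax q r) (Suc m) = lax q r \<odot> ?P"
    by (simp add: pdo_power_def)
  have S: "coeff_act (coeff ?P (- 1)) f = ?S * f" for f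
    using neg[of 0] by simp

  \<comment> \<open>Downward recursion by \<open>tail_step\<close> from order -1, where the tail is
    the adjoint. Differentiating \<integral> (g u) cancels the new coefficient.\<close>
  have tail: "tail ?P g (- 1 - int s) = (neg_deriv ^^ s) ((neg_lax q r ^^ m) g)
      + lax_pairs q r m (\<lambda>u v. \<integral> (g * u) * (neg_deriv ^^ s) v)" for g s
  proof (induction s)
    case 0
    then show ?case
      using adj[of g] by (simp add: adj_apply_def ac_simps)
  next
    case (Suc s)
    have "tail ?P g (- 1 - int (Suc s)) = tail ?P g ((- 1 - int s) - 1)"
      by (rule arg_cong[of _ _ "tail ?P g"]) simp
    also have "\<dots> = lax_pairs q r m (\<lambda>u v. g * u * (neg_deriv ^^ s) v)
        - \<partial> (tail ?P g (- 1 - int s))"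
      unfolding tail_step neg by (simp add: mult.commute[of _ g] mult.assoc flip: lax_pairs_cmult)
    also have "\<dots> = (neg_deriv ^^ Suc s) ((neg_lax q r ^^ m) g)
        + lax_pairs q r m (\<lambda>u v. \<integral> (g * u) * (neg_deriv ^^ Suc s) v)"
      unfolding Suc
      by (simp add: derivation_add derivation_mult neg_deriv_def lax_pairs_add lax_pairs_minus
          flip: lax_pairs_derivation)
    finally show ?case .
  qed

  have "coeff (lax q r \<odot> ?P) (- 1 - int s)
      = (0, lax_pairs q r (Suc m) (\<lambda>u v. u * (neg_deriv ^^ s) v))" for s
  proof -
    have "coeff ?P (- 1 - int s - 1) = (0, lax_pairs q r m (\<lambda>u v. u * (neg_deriv ^^ Suc s) v))"
      using neg[of "Suc s"] by (simp add: algebra_simps)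
    then show ?thesis
      unfolding coeff_lax_mult tail neg lax_pairs_Suc
      by (simp add: lax_fun_def neg_deriv_def derivation_mult distrib_left distrib_right lax_pairs_add
          lax_pairs_minus mult.assoc lax_pairs_cmult flip: lax_pairs_derivation)
  qed
  moreover have "pdo_apply (lax q r \<odot> ?P) f = (lax_fun q r ^^ Suc m) f
      - lax_pairs q r (Suc m) (\<lambda>u v. u * \<integral> (v * f))" for f
  proof -
    define R where "R g = lax_pairs q r m (\<lambda>u v. \<integral> (g * u) * v)" for g
    \<comment> \<open>The residue term and the last two integrals cancel against the corrections in
      \<open>pdo_apply_lax_mult\<close>.\<close>
    have "lax_pairs q r m (\<lambda>u v. lax_fun q r (u * \<integral> (v * f)))
      = lax_pairs q r m (\<lambda>u v. lax_fun q r u * \<integral> (v * f)) + ?S * f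
        - q * \<integral> (lax_pairs q r m (\<lambda>u v. \<integral> (r * u) * v) * f)
        - r * \<integral> (lax_pairs q r m (\<lambda>u v. \<integral> (q * u) * v) * f)"
      unfolding lax_fun_times_antiderivative
      by (simp add: lax_pairs_add lax_pairs_diff lax_pairs_cmult lax_pairs_cmult_right
          lax_pairs_antiderivative flip: mult.assoc)
    then show ?thesis
      unfolding pdo_apply_lax_mult app adj S lax_fun_diff lax_pairs_Suc
      unfolding R_def[symmetric]
      by (simp add: lax_pairs_lax_fun antiderivative_add algebra_simps)
  qed
  moreover have "adj_apply (lax q r \<odot> ?P) f = (neg_lax q r ^^ Suc m) f
      + lax_pairs q r (Suc m) (\<lambda>u v. \<integral> (f * u) * v)" for f
  proof -
    \<comment> \<open>Integrating the skew-adjointness identity moves L from u to f.\<close>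
    have "\<integral> (f * lax_fun q r u) * v = u * v * f + \<integral> (q * u) * v * \<integral> (r * f)
        + \<integral> (r * u) * v * \<integral> (q * f) - \<integral> (lax_fun q r f * u) * v" for u v
    proof -
      have "\<integral> (u * lax_fun q r f + lax_fun q r u * f)
          = u * f + \<integral> (q * u) * \<integral> (r * f) + \<integral> (r * u) * \<integral> (q * f)"
        by (simp add: lax_fun_skew)
      then have eq: "\<integral> (f * lax_fun q r u) = u * f + \<integral> (q * u) * \<integral> (r * f)
          + \<integral> (r * u) * \<integral> (q * f) - \<integral> (lax_fun q r f * u)"
        unfolding antiderivative_add by (simp add: ac_simps) (simp add: algebra_simps)
      show ?thesis
        by (simp only: eq) (simp add: algebra_simps)
    qed
    then have pairs: "lax_pairs q r m (\<lambda>u v. \<integral> (f * lax_fun q r u) * v)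
      = ?S * f + lax_pairs q r m (\<lambda>u v. \<integral> (q * u) * v) * \<integral> (r * f)
        + lax_pairs q r m (\<lambda>u v. \<integral> (r * u) * v) * \<integral> (q * f)
        - lax_pairs q r m (\<lambda>u v. \<integral> (lax_fun q r f * u) * v)"
      by (simp add: lax_pairs_add lax_pairs_diff lax_pairs_cmult_right)
    have "adj_apply ?P (\<partial> f) + adj_apply ?P (q * \<integral> (r * f)) + adj_apply ?P (r * \<integral> (q * f))
        = adj_apply ?P (lax_fun q r f)"
      by (simp add: lax_fun_def adj_apply_add)
    then have "adj_apply (lax q r \<odot> ?P) f = ?S * f + \<integral> (q * f) * adj_apply ?P r
        + \<integral> (r * f) * adj_apply ?P q - adj_apply ?P (lax_fun q r f)"
      by (simp add: adj_apply_lax_mult S algebra_simps)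
    moreover have "(neg_lax q r ^^ Suc m) f = - (neg_lax q r ^^ m) (lax_fun q r f)"
      by (simp only: neg_lax_funpow) (simp add: funpow_swap1)
    ultimately show ?thesis
      unfolding lax_pairs_Suc pairs adj
      by (simp add: algebra_simps)
  qed
  ultimately show ?case
    unfolding power by blast
qed

section \<open>Adjoint and residue of the powers\<close>

lemma pdo_apply_pos_part: "pdo_apply (pos_part P) f = pdo_apply P f"
  unfolding pdo_apply_def pos_part.rep_eq by (rule sum.cong) auto

lemma pdo_apply_lax_power:
  "pdo_apply (pdo_power (lax q r) m) f
    = (lax_fun q r ^^ m) f - lax_pairs q r m (\<lambda>u v. u * \<integral> (v * f))"
  using lax_power_represented by blast

lemma adj_apply_lax_power:
  "adj_apply (pdo_power (lax q r) m) f
    = (neg_lax q r ^^ m) f + lax_pairs q r m (\<lambda>u v. \<integral> (f * u) * v)"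
  using lax_power_represented by blast

text \<open>Exchanging the members of all pairs costs (-1)^(m-1), which turns the plus sign of the
  adjoint formula into (-1)^m times the minus sign of the action.\<close>

lemma lax_power_adjoint:
  "adj_apply (pdo_power (lax q r) m) f = (- 1) ^ m *s pdo_apply (pdo_power (lax q r) m) f"
proof (cases m)
  case 0
  then show ?thesis
    by (simp add: adj_apply_lax_power pdo_apply_lax_power)
next
  case (Suc k)
  have "lax_pairs q r (Suc k) (\<lambda>u v. v * \<integral> (u * f))
      = (- 1) ^ k *s lax_pairs q r (Suc k) (\<lambda>u v. u * \<integral> (v * f))"
    by (rule lax_pairs_swap) (simp_all add: scale_mult_left scale_mult_right antiderivative_scale)
  then have "lax_pairs q r m (\<lambda>u v. \<integral> (f * u) * v)
      = (- 1) ^ k *s lax_pairs q r m (\<lambda>u v. u * \<integral> (v * f))"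
    by (simp add: Suc mult.commute)
  then show ?thesis
    unfolding adj_apply_lax_power pdo_apply_lax_power neg_lax_funpow
    by (simp add: Suc scale_right_diff_distrib)
qed

text \<open>The coefficient of \<partial>^(-1) in the m-th power of the Lax operator, by
  \<open>lax_power_represented\<close> at s = 0.\<close>

definition residue :: "'a \<Rightarrow> 'a \<Rightarrow> nat \<Rightarrow> 'a"
  where "residue q r m = lax_pairs q r m (\<lambda>u v. u * v)"

text \<open>Exchanging the members turns one half of the pairs into the other with sign (-1)^(m-1) =
  -1, so the halves cancel.\<close>

lemma residue_even: "even m \<Longrightarrow> residue q r m = 0"
proof (cases m)
  case (Suc k)
  assume "even m"
  then have "half_pairs r q m (\<lambda>u v. v * u) = - half_pairs q r m (\<lambda>u v. u * v)"
    unfolding Suc by (subst half_pairs_swap) (simp_all add: scale_mult_left scale_mult_right)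
  then show ?thesis
    by (simp add: residue_def lax_pairs_def mult.commute)
qed (simp add: residue_def)

text \<open>Compares \<open>lax_pairs_Suc\<close> with \<open>lax_pairs_Suc'\<close> for the product
  of the members; the difference of their inner sums is the derivative plus four integral
  terms.\<close>

lemma derivation_residue:
  fixes q r :: 'a
  assumes "odd m"
  defines "a \<equiv> pdo_apply (pdo_power (lax q r) m) q" and "b \<equiv> pdo_apply (pdo_power (lax q r) m) r"
  shows "\<partial> (residue q r m) = 2 *s (r * a + q * b)"
proof -
  let ?PS = "lax_pairs q r m"
  have arith: "D = z + w - x - y - e - f - g - h"
    if "A + x + y = B + z + w" and "A - B = D + e + f + g + h" for A B D e f g h w x y z :: 'a
  proof -
    have "D = (A - B) - e - f - g - h"
      using that(2) by simp
    moreover have "A - B = z + w - x - y"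
      using that(1) by (simp add: algebra_simps)
    ultimately show ?thesis
      by simp
  qed
  have "(neg_lax q r ^^ m) f = - pdo_apply (pdo_power (lax q r) m) f - ?PS (\<lambda>u v. \<integral> (f * u) * v)" for f
    using lax_power_adjoint[of q r m f] assms(1) by (simp add: adj_apply_lax_power eq_diff_eq)
  then have adj: "(neg_lax q r ^^ m) q = - a - ?PS (\<lambda>u v. \<integral> (q * u) * v)"
    "(neg_lax q r ^^ m) r = - b - ?PS (\<lambda>u v. \<integral> (r * u) * v)"
    by (simp_all only: a_def b_def)
  have app: "(lax_fun q r ^^ m) q = a + ?PS (\<lambda>u v. u * \<integral> (v * q))"
    "(lax_fun q r ^^ m) r = b + ?PS (\<lambda>u v. u * \<integral> (v * r))"
    by (simp_all add: a_def b_def pdo_apply_lax_power)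
  have "?PS (\<lambda>u v. lax_fun q r u * v) + q * (neg_lax q r ^^ m) r + r * (neg_lax q r ^^ m) q
      = ?PS (\<lambda>u v. u * neg_lax q r v) + (lax_fun q r ^^ m) q * r + (lax_fun q r ^^ m) r * q"
    using lax_pairs_Suc[of q r m "\<lambda>u v. u * v"] lax_pairs_Suc'[of q r m "\<lambda>u v. u * v"] by simp
  moreover have "?PS (\<lambda>u v. lax_fun q r u * v) - ?PS (\<lambda>u v. u * neg_lax q r v)
      = \<partial> (residue q r m) + r * ?PS (\<lambda>u v. u * \<integral> (v * q)) + q * ?PS (\<lambda>u v. u * \<integral> (v * r))
        + r * ?PS (\<lambda>u v. \<integral> (q * u) * v) + q * ?PS (\<lambda>u v. \<integral> (r * u) * v)"
  proof -
    have "lax_fun q r u * v - u * neg_lax q r v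
        = \<partial> (u * v) + r * (u * \<integral> (v * q)) + q * (u * \<integral> (v * r))
          + r * (\<integral> (q * u) * v) + q * (\<integral> (r * u) * v)" for u v
      by (simp add: lax_fun_def neg_lax_def derivation_mult algebra_simps)
    then show ?thesis
      unfolding residue_def lax_pairs_diff[symmetric]
      by (simp add: lax_pairs_add lax_pairs_derivation lax_pairs_cmult)
  qed
  ultimately have "\<partial> (residue q r m)
      = (lax_fun q r ^^ m) q * r + (lax_fun q r ^^ m) r * q
        - q * (neg_lax q r ^^ m) r - r * (neg_lax q r ^^ m) q
        - r * ?PS (\<lambda>u v. u * \<integral> (v * q)) - q * ?PS (\<lambda>u v. u * \<integral> (v * r))
        - r * ?PS (\<lambda>u v. \<integral> (q * u) * v) - q * ?PS (\<lambda>u v. \<integral> (r * u) * v)"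
    by (rule arith)
  \<comment> \<open>The pair sums in \<open>adj\<close> and \<open>app\<close> cancel the four
    integral terms; r a and q b each remain twice.\<close>
  also have "\<dots> = 2 *s (r * a + q * b)"
    unfolding adj app scale_two
    by (simp add: distrib_left distrib_right right_diff_distrib mult.commute[of _ q]
        mult.commute[of _ r])
  finally show ?thesis .
qed

section \<open>The recursion\<close>

lemma pdo_apply_lax_power_Suc:
  "pdo_apply (pdo_power (lax q r) (Suc m)) f
    = lax_fun q r (pdo_apply (pdo_power (lax q r) m) f) + residue q r m * f
      - (- 1) ^ m *s (q * \<integral> (pdo_apply (pdo_power (lax q r) m) r * f)
          + r * \<integral> (pdo_apply (pdo_power (lax q r) m) q * f))"
proof -
  have "coeff_act (coeff (pdo_power (lax q r) m) (- 1)) f = residue q r m * f"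
    using lax_power_represented[of q r m, THEN conjunct1, rule_format, of 0] by (simp add: residue_def)
  moreover have "pdo_power (lax q r) (Suc m) = lax q r \<odot> pdo_power (lax q r) m"
    by (simp add: pdo_power_def)
  ultimately show ?thesis
    by (simp add: pdo_apply_lax_mult lax_power_adjoint scale_mult_left scale_mult_right
        antiderivative_scale scale_right_distrib diff_diff_eq)
qed

text \<open>For odd m, S is the residue, a and b are the values of \<open>B q r m\<close> at q and
  r, c and d those of \<open>B q r (m + 1)\<close>. The left side is then the value of
  \<open>B q r (m + 2)\<close> at q.\<close>

lemma recursion_identity:
  assumes S: "\<partial> S = 2 *s (r * a + q * b)"
    and c: "c = lax_fun q r a + S * q + q * \<integral> (b * q) + r * \<integral> (a * q)"
    and d: "d = lax_fun q r b + S * r + q * \<integral> (b * r) + r * \<integral> (a * r)"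
  shows "lax_fun q r c - q * \<integral> (d * q) - r * \<integral> (c * q) = R11 q r a + R12 q r b"
proof -
  have S_int: "S = \<integral> (r * a) + \<integral> (q * b) + \<integral> (r * a) + \<integral> (q * b)"
    using arg_cong[OF S, of "\<integral>"] by (simp add: scale_two antiderivative_add add.assoc)
  \<comment> \<open>Both integrals of S here cancel against those in \<open>dq\<close> and
    \<open>cq\<close>. The remaining q \<partial> S supplies two of the three copies of q r a and q
    q b.\<close>
  have LSq: "lax_fun q r (S * q)
      = \<partial> q * S + q * (2 *s (r * a + q * b)) + q * \<integral> (r * q * S) + r * \<integral> (q * q * S)"
    by (simp add: lax_fun_def derivation_mult S mult.assoc mult.commute[of S] add.commute)
  have Lc: "lax_fun q r c = lax_fun q r (lax_fun q r a) + lax_fun q r (S * q)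
      + lax_fun q r (q * \<integral> (b * q)) + lax_fun q r (r * \<integral> (a * q))"
    by (simp add: c lax_fun_add)
  have dq: "\<integral> (d * q) = \<integral> (q * \<partial> b) + \<integral> (q * q * \<integral> (r * b)) + \<integral> (q * r * \<integral> (q * b))
      + \<integral> (r * q * S) + \<integral> (q * q * \<integral> (r * b)) + \<integral> (q * r * \<integral> (r * a))"
    unfolding d lax_fun_def antiderivative_add[symmetric]
    by (rule arg_cong[of _ _ "\<integral>"]) (simp add: algebra_simps)
  have cq: "\<integral> (c * q) = \<integral> (q * \<partial> a) + \<integral> (q * q * \<integral> (r * a)) + \<integral> (q * r * \<integral> (q * a))
      + \<integral> (q * q * S) + \<integral> (q * q * \<integral> (q * b)) + \<integral> (q * r * \<integral> (q * a))"
    unfolding c lax_fun_def antiderivative_add[symmetric]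
    by (rule arg_cong[of _ _ "\<integral>"]) (simp add: algebra_simps)
  \<comment> \<open>The source of the terms with 2 q_x \<partial>^(-1) in the first row.\<close>
  have qS: "\<partial> q * S = 2 *s (\<partial> q * \<integral> (r * a)) + 2 *s (\<partial> q * \<integral> (q * b))"
    unfolding S_int scale_two by (simp add: algebra_simps)
  show ?thesis
    unfolding Lc LSq dq cq qS R11_def R12_def lax_fun_times_antiderivative scale_two scale_three
    by (simp add: algebra_simps)
qed

text \<open>L is symmetric in q and r, so the second row is the first with q and r
  exchanged.\<close>

lemma R_swap: "R22 q r f = R11 r q f" "R21 q r f = R12 r q f"
  by (simp_all add: R11_def R12_def R21_def R22_def lax_fun_swap_fun[of q r] ac_simps)

lemma flow_recursion:
  fixes q r :: 'a
  assumes "odd m"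
  defines "a \<equiv> pdo_apply (B q r m) q" and "b \<equiv> pdo_apply (B q r m) r"
  shows "pdo_apply (B q r (m + 2)) q = R11 q r a + R12 q r b"
    and "pdo_apply (B q r (m + 2)) r = R21 q r a + R22 q r b"
proof -
  define S where "S = residue q r m"
  define c where "c = pdo_apply (pdo_power (lax q r) (Suc m)) q"
  define d where "d = pdo_apply (pdo_power (lax q r) (Suc m)) r"
  have S: "\<partial> S = 2 *s (r * a + q * b)"
    using derivation_residue[OF assms(1)] by (simp add: S_def a_def b_def B_def pdo_apply_pos_part)
  have step: "pdo_apply (pdo_power (lax q r) (Suc m)) f
      = lax_fun q r (pdo_apply (pdo_power (lax q r) m) f) + S * f + q * \<integral> (b * f) + r * \<integral> (a * f)" for f
    using assms(1) pdo_apply_lax_power_Suc[of q r m f]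
    by (simp add: a_def b_def B_def pdo_apply_pos_part S_def add.assoc)
  have c: "c = lax_fun q r a + S * q + q * \<integral> (b * q) + r * \<integral> (a * q)"
    by (simp add: c_def step) (simp add: a_def B_def pdo_apply_pos_part)
  have d: "d = lax_fun q r b + S * r + q * \<integral> (b * r) + r * \<integral> (a * r)"
    by (simp add: d_def step) (simp add: b_def B_def pdo_apply_pos_part)
  \<comment> \<open>Now the exponent m + 1 is even: the residue vanishes and the sign of the
    integrals is reversed.\<close>
  have step': "pdo_apply (B q r (m + 2)) f = lax_fun q r (pdo_apply (pdo_power (lax q r) (Suc m)) f)
      - q * \<integral> (d * f) - r * \<integral> (c * f)" for f
    using assms(1) pdo_apply_lax_power_Suc[of q r "Suc m" f]
    by (simp add: c_def d_def B_def pdo_apply_pos_part residue_even diff_diff_eq)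
  show "pdo_apply (B q r (m + 2)) q = R11 q r a + R12 q r b"
    unfolding step' c_def[symmetric] by (rule recursion_identity[OF S c d])
  \<comment> \<open>The same identity with q and r, a and b, c and d exchanged.\<close>
  have "lax_fun r q d - r * \<integral> (c * r) - q * \<integral> (d * r) = R11 r q b + R12 r q a"
  proof (rule recursion_identity)
    show "\<partial> S = 2 *s (q * b + r * a)"
      by (simp add: S add.commute)
    show "d = lax_fun r q b + S * r + r * \<integral> (a * r) + q * \<integral> (b * r)"
      "c = lax_fun r q a + S * q + r * \<integral> (a * q) + q * \<integral> (b * q)"
      by (simp_all add: c d lax_fun_swap_fun[of q r] ac_simps)
  qed
  then show "pdo_apply (B q r (m + 2)) r = R21 q r a + R22 q r b"
    unfolding step' d_def[symmetric]
    by (simp add: R_swap lax_fun_swap_fun[of q r] diff_diff_eq add.commute)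
qed

end

theorem theorem3p1:
  fixes scale :: "'k::comm_ring_1 \<Rightarrow> 'a::comm_ring \<Rightarrow> 'a"
    and D :: "'a \<Rightarrow> 'a"
    and q r :: 'a
    and dt :: "nat \<Rightarrow> 'a \<Rightarrow> 'a"
    and m :: nat
  assumes "differential_algebra scale D"
    and "differential_algebra.CKP_flow scale D q r dt"
    and "odd m"
  shows "dt (m + 2) q = differential_algebra.R11 scale D q r (dt m q)
                       + differential_algebra.R12 scale D q r (dt m r)
      \<and> dt (m + 2) r = differential_algebra.R21 scale D q r (dt m q)
                       + differential_algebra.R22 scale D q r (dt m r)"
proof -
  interpret differential_algebra scale D
    by fact
  have "dt k q = pdo_apply (B q r k) q" "dt k r = pdo_apply (B q r k) r" if "odd k" for k
    using assms(2) that by (simp_all add: CKP_flow_def)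
  then show ?thesis
    using flow_recursion[OF assms(3), of q r] assms(3) by simp
qed

end
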